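(* Let $(a_i)$ be a representing sequence with $a_1=k$, and let $(b_i)$ be the $1$-promotion of $(a_i)$. Let $w$ be the representation word of $(a_i)$ and $v$ the representation word of $(b_i)$. Let $\varphi_k$ be the morphism from words over $\{0,\dots,k\}$ to words over $\{0,\dots,k+1\}$ given by $\varphi_k(0)=01$ and $\varphi_k(i)=i+1$ for $i>0$ (applied letter by letter to infinite words). Then $\varphi_k(w)=v$.
   Context: A representing sequence is a strictly increasing sequence $(a_i)_{i\ge0}$ of positive integers with $a_0=1$. For $n\ge1$ with $a_j\le n<a_{j+1}$, the $(a_i)$-representation of $n$ is the digit string $d_j\cdots d_0$ with $n=\sum d_ia_i$ and $\sum d_i$ minimal (greedy); the representation of $0$ is the digit $0$. $n\ge0$ is $2$-volatile if the representation of $n+1$ ends in at least two zeros. The representation word of $(a_i)$ is the infinite word $w$ with $w[n]=a_1$ if $n$ is $2$-volatile and otherwise $w[n]$ equals the last digit of the representation of $n$. The $1$-promotion of $(a_i)$ is the sequence $(b_i)_{i\ge0}$ defined recursively by $b_0=a_0=1$ and, for $i\ge1$, writing $d_{i-1}d_{i-2}\cdots d_0$ for the $(a_h)$-representation of $a_i-1$: $b_i=1+(d_0+1)b_0+\sum_{\ell=1}^{i-1}d_\ell b_\ell$ if $d_0>0$, and $b_i=1+\sum_{\ell=0}^{i-1}d_\ell b_\ell$ otherwise. *)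

theory Defs
  imports "HOL-Library.Stream" "HOL-Library.FuncSet"
begin

definition representing_seq :: "(nat \<Rightarrow> nat) \<Rightarrow> bool" where
  "representing_seq a \<longleftrightarrow> strict_mono a \<and> a 0 = 1"

text \<open>Digit strings are lists \<open>[d\<^sub>j, \<dots>, d\<^sub>0]\<close>, most significant digit first.\<close>

fun greedy_digits :: "(nat \<Rightarrow> nat) \<Rightarrow> nat \<Rightarrow> nat \<Rightarrow> nat list" where
  "greedy_digits a 0 n = [n div a 0]"
| "greedy_digits a (Suc j) n = n div a (Suc j) # greedy_digits a j (n mod a (Suc j))"

text \<open>The representation is the greedy one. Minimality of the digit sum alone would not
  determine it: for a sequence starting 1, 4, 5, 8 both 8 + 1 and 5 + 4 represent 9 with
  digit sum 2. For \<open>n \<ge> 1\<close> the leading index is the \<open>j\<close> with \<open>a j \<le> n < a (j + 1)\<close>.\<close>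

definition representation :: "(nat \<Rightarrow> nat) \<Rightarrow> nat \<Rightarrow> nat list" where
  "representation a n = (if n = 0 then [0] else greedy_digits a (GREATEST j. a j \<le> n) n)"

text \<open>The digit \<open>d\<^sub>l\<close>, meaningful for \<open>l < length (representation a n)\<close>.\<close>

definition digit :: "(nat \<Rightarrow> nat) \<Rightarrow> nat \<Rightarrow> nat \<Rightarrow> nat" where
  "digit a n l = rev (representation a n) ! l"

definition volatile2 :: "(nat \<Rightarrow> nat) \<Rightarrow> nat \<Rightarrow> bool" where
  "volatile2 a n \<longleftrightarrow> (\<exists>ds. representation a (n + 1) = ds @ [0, 0])"

definition representation_word :: "(nat \<Rightarrow> nat) \<Rightarrow> nat stream" where
  "representation_word a =
     smap (\<lambda>n. if volatile2 a n then a 1 else last (representation a n)) nats"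

text \<open>For a representing sequence, \<open>a (Suc i) - 1\<close> has exactly \<open>Suc i\<close> digits.\<close>

fun promotion1 :: "(nat \<Rightarrow> nat) \<Rightarrow> nat \<Rightarrow> nat" where
  "promotion1 a 0 = 1"
| "promotion1 a (Suc i) =
     (if digit a (a (Suc i) - 1) 0 > 0
      then 1 + (digit a (a (Suc i) - 1) 0 + 1) * promotion1 a 0
             + (\<Sum>l = 1..i. digit a (a (Suc i) - 1) l * promotion1 a l)
      else 1 + (\<Sum>l = 0..i. digit a (a (Suc i) - 1) l * promotion1 a l))"

definition phi :: "nat \<Rightarrow> nat \<Rightarrow> nat list" where
  "phi k = (\<lambda>i\<in>{0..k}. if i = 0 then [0, 1] else [i + 1])"

text \<open>Image of an infinite word under a non-erasing morphism given by its letter images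
  (the library function \<open>flat\<close> is only meaningful when no letter image is empty).\<close>

definition morphism_image :: "('a \<Rightarrow> 'b list) \<Rightarrow> 'a stream \<Rightarrow> 'b stream" where
  "morphism_image h w = flat (smap h w)"

lemma snth_representation_word:
  "representation_word a !! n = (if volatile2 a n then a 1 else last (representation a n))"
  by (simp add: representation_word_def)

lemma representing_seq_leading_index:
  assumes "representing_seq a" and "n \<ge> 1"
  shows "a (GREATEST j. a j \<le> n) \<le> n" and "n < a ((GREATEST j. a j \<le> n) + 1)"
proof -
  have bound: "j \<le> n" if "a j \<le> n" for j
    using assms(1) that strict_mono_imp_increasing[of a j] by (simp add: representing_seq_def)
  have "a 0 \<le> n" using assms by (simp add: representing_seq_def)
  then show "a (GREATEST j. a j \<le> n) \<le> n"
    using GreatestI_nat[of "\<lambda>j. a j \<le> n" 0 n] bound by blast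
  show "n < a ((GREATEST j. a j \<le> n) + 1)"
  proof (rule ccontr)
    define G where "G = (GREATEST j. a j \<le> n)"
    assume "\<not> ?thesis"
    then have "a (G + 1) \<le> n" unfolding G_def by (simp only: not_less)
    then have "G + 1 \<le> G"
      unfolding G_def by (rule Greatest_le_nat) (rule bound)
    then show False by simp
  qed
qed

lemma length_greedy_digits: "length (greedy_digits a j n) = Suc j"
  by (induction j arbitrary: n) auto

lemma greedy_digits_sum:
  assumes "a 0 = 1"
  shows "(\<Sum>l\<le>j. rev (greedy_digits a j n) ! l * a l) = n"
proof (induction j arbitrary: n)
  case 0
  then show ?case using assms by simp
next
  case (Suc j)
  have "(\<Sum>l\<le>Suc j. rev (greedy_digits a (Suc j) n) ! l * a l)
      = (\<Sum>l\<le>j. rev (greedy_digits a j (n mod a (Suc j))) ! l * a l) + n div a (Suc j) * a (Suc j)"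
    by (simp add: nth_append length_greedy_digits)
  also have "\<dots> = n mod a (Suc j) + n div a (Suc j) * a (Suc j)"
    by (simp only: Suc)
  also have "\<dots> = n" by (rule mod_div_mult_eq)
  finally show ?case .
qed

lemma representation_sum:
  assumes "representing_seq a"
  shows "(\<Sum>l<length (representation a n). digit a n l * a l) = n"
proof (cases "n = 0")
  case True
  then show ?thesis by (simp add: representation_def digit_def)
next
  case False
  then show ?thesis
    using greedy_digits_sum[of a "GREATEST j. a j \<le> n" n] assms
    by (simp add: representation_def digit_def representing_seq_def
        length_greedy_digits lessThan_Suc_atMost)
qed

end

theory Submission
  imports Defs
begin

text \<open>Read the digits of \<open>n\<close> with respect to \<open>a\<close> in the sequence \<open>b\<close>, after increasing the last
  digit by one if it is positive. The resulting number \<open>P n\<close> is the position in \<open>v\<close> at which the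
  image of \<open>w[n]\<close> starts. Subtracting one from \<open>n + 1\<close> either decreases the last digit or replaces
  the lowest nonzero digit \<open>d\<^sub>j\<close>, \<open>j \<ge> 1\<close>, by \<open>d\<^sub>j - 1\<close> followed by the digits of \<open>a j - 1\<close>; since
  \<open>b j = 1 + P (a j - 1)\<close>, this shows that \<open>P (n + 1) - P n\<close> is 2 if \<open>n + 1\<close> ends in 1, and 1
  otherwise. Hence \<open>P\<close> is strictly increasing, so promoted digit strings satisfy the greedy
  condition for \<open>b\<close>, and the last digits of the numbers \<open>P n\<close> and \<open>P n + 1\<close> can be read off.\<close>

section \<open>Greedy digit sequences\<close>

text \<open>Padding with zeros allows representations of different lengths to be compared index by
  index.\<close>

definition rep_digits :: "(nat \<Rightarrow> nat) \<Rightarrow> nat \<Rightarrow> nat \<Rightarrow> nat" where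
  "rep_digits a n l = (if l < length (representation a n) then digit a n l else 0)"

text \<open>The usual criterion for greedy expansions: the digits below \<open>j\<close> form a
  remainder modulo \<open>a j\<close>.\<close>

definition greedy_seq :: "(nat \<Rightarrow> nat) \<Rightarrow> (nat \<Rightarrow> nat) \<Rightarrow> bool" where
  "greedy_seq a d \<longleftrightarrow> (\<forall>j. (\<Sum>l<j. d l * a l) < a j)"

lemma greedy_digits_partial_sum_less:
  assumes "\<And>j. a j > 0" "n < a (Suc J)" "a 0 = 1" "j \<le> Suc J"
  shows "(\<Sum>l<j. rev (greedy_digits a J n) ! l * a l) < a j"
  using assms(2,4)
proof (induction J arbitrary: n)
  case 0
  then show ?case using assms by (cases j) auto
next
  case (Suc J)
  show ?case
  proof (cases "j = Suc (Suc J)")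
    case True
    then show ?thesis
      using greedy_digits_sum[of a "Suc J" n, OF \<open>a 0 = 1\<close>] Suc.prems
      by (simp only: lessThan_Suc_atMost)
  next
    case False
    then have "j \<le> Suc J" using Suc.prems by simp
    moreover have "(\<Sum>l<j. rev (greedy_digits a (Suc J) n) ! l * a l)
        = (\<Sum>l<j. rev (greedy_digits a J (n mod a (Suc J))) ! l * a l)"
      using \<open>j \<le> Suc J\<close> by (intro sum.cong) (auto simp: nth_append length_greedy_digits)
    ultimately show ?thesis
      using Suc.IH[of "n mod a (Suc J)"] assms(1)[of "Suc J"] by simp
  qed
qed

text \<open>Division with remainder by \<open>a L\<close>: greediness makes the lower sums
  remainders, so the top digits are equal quotients, and the induction goes on with what is
  left.\<close>

lemma greedy_seq_unique:
  assumes "greedy_seq a d" "greedy_seq a e"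
    and "(\<Sum>l<L. d l * a l) = (\<Sum>l<L. e l * a l)" "l < L"
  shows "d l = e l"
  using assms(3,4)
proof (induction L)
  case (Suc L)
  have *: "(\<Sum>l<L. d l * a l) < a L" "(\<Sum>l<L. e l * a l) < a L"
    using assms by (auto simp: greedy_seq_def)
  have eq: "(\<Sum>l<L. d l * a l) + d L * a L = (\<Sum>l<L. e l * a l) + e L * a L"
    using Suc.prems by simp
  have "d L = ((\<Sum>l<L. d l * a l) + d L * a L) div a L"
    using * by simp
  also have "\<dots> = e L"
    unfolding eq using * by simp
  finally have "d L = e L" .
  with Suc eq show ?case by (cases "l = L") auto
qed simp

context
  fixes a :: "nat \<Rightarrow> nat"
  assumes rep: "representing_seq a"
begin

lemma representing_seq_pos: "a j > 0"
  using rep strict_mono_less_eq[of a 0 j] by (simp add: representing_seq_def)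

lemma representing_seq_gt_index: "j < a j"
proof (induction j)
  case 0
  show ?case by (rule representing_seq_pos)
next
  case (Suc j)
  then show ?case using rep strict_monoD[of a j "Suc j"] by (simp add: representing_seq_def)
qed

lemma less_representing_seq_length: "n < a (length (representation a n))"
proof (cases "n = 0")
  case True
  then show ?thesis using representing_seq_pos by simp
next
  case False
  then show ?thesis
    using representing_seq_leading_index(2)[OF rep, of n]
    by (simp add: representation_def length_greedy_digits)
qed

lemma sum_rep_digits:
  assumes "n < a L"
  shows "(\<Sum>l<L. rep_digits a n l * a l) = n"
proof -
  let ?m = "length (representation a n)"
  have sum: "(\<Sum>l<?m. rep_digits a n l * a l) = n"
    using representation_sum[OF rep, of n] by (simp add: rep_digits_def)
  \<comment> \<open>Zero is separate because its representation has length 1 although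
    \<open>L\<close> may be 0.\<close>
  consider "n = 0" | "?m \<le> L" | "n > 0" "L < ?m" by linarith
  then show ?thesis
  proof cases
    case 1
    then show ?thesis by (simp add: rep_digits_def digit_def representation_def)
  next
    case 2
    then have "(\<Sum>l<L. rep_digits a n l * a l) = (\<Sum>l<?m. rep_digits a n l * a l)"
      by (intro sum.mono_neutral_right) (auto simp: rep_digits_def)
    with sum show ?thesis by simp
  next
    case 3
    then have "?m = Suc (GREATEST j. a j \<le> n)"
      by (simp add: representation_def length_greedy_digits)
    then have "a L \<le> a (GREATEST j. a j \<le> n)"
      using 3 rep by (auto simp: representing_seq_def strict_mono_less_eq)
    with representing_seq_leading_index(1)[OF rep, of n] 3 assms show ?thesis by simp
  qed
qed

lemma greedy_seq_rep_digits: "greedy_seq a (rep_digits a n)"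
  unfolding greedy_seq_def
proof
  fix j
  let ?m = "length (representation a n)"
  show "(\<Sum>l<j. rep_digits a n l * a l) < a j"
  proof (cases "n < a j")
    case True
    then show ?thesis by (simp add: sum_rep_digits)
  next
    case False
    then have n: "n \<noteq> 0" using representing_seq_pos[of j] by (metis neq0_conv)
    define J where "J = (GREATEST j. a j \<le> n)"
    have m: "representation a n = greedy_digits a J n" "?m = Suc J"
      using n by (simp_all add: representation_def length_greedy_digits J_def)
    have "a j < a (Suc J)"
      using False less_representing_seq_length[of n] m by simp
    then have j: "j \<le> Suc J"
      using rep by (simp add: representing_seq_def strict_mono_less)
    have "(\<Sum>l<j. rev (greedy_digits a J n) ! l * a l) < a j"
      using less_representing_seq_length[of n] m rep j
      by (intro greedy_digits_partial_sum_less representing_seq_pos)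
        (auto simp: representing_seq_def)
    moreover have "(\<Sum>l<j. rep_digits a n l * a l)
        = (\<Sum>l<j. rev (greedy_digits a J n) ! l * a l)"
      using j m by (intro sum.cong) (auto simp: rep_digits_def digit_def)
    ultimately show ?thesis by simp
  qed
qed

lemma rep_digits_eq_0:
  assumes "n < a l" "l \<le> i"
  shows "rep_digits a n i = 0"
proof -
  have "a l \<le> a i" "a l \<le> a (Suc i)"
    using rep assms by (auto simp: representing_seq_def strict_mono_less_eq)
  then have "(\<Sum>l<Suc i. rep_digits a n l * a l) = (\<Sum>l<i. rep_digits a n l * a l)"
    using assms by (simp only: sum_rep_digits)
  then show ?thesis using representing_seq_pos[of i] by simp
qed

text \<open>Uniqueness settles the indices below \<open>L\<close>, and both sides vanish from
  \<open>L\<close> on. All later identifications of representations use this criterion.\<close>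

lemma rep_digits_eqI:
  assumes "greedy_seq a d" "\<And>l. l \<ge> L \<Longrightarrow> d l = 0" "(\<Sum>l<L. d l * a l) = n"
  shows "rep_digits a n = d"
proof
  fix l
  have n: "n < a L" using assms(1,3) by (auto simp: greedy_seq_def)
  show "rep_digits a n l = d l"
  proof (cases "l < L")
    case True
    show ?thesis
      using sum_rep_digits[OF n] assms(3) True
      by (intro greedy_seq_unique[OF greedy_seq_rep_digits assms(1), of n L]) auto
  next
    case False
    then show ?thesis using rep_digits_eq_0[OF n, of l] assms(2) by simp
  qed
qed

lemma rep_digits_truncate:
  assumes "greedy_seq a d"
  shows "rep_digits a (\<Sum>l<j. d l * a l) = (\<lambda>l. if l < j then d l else 0)"
proof (rule rep_digits_eqI[of _ j])
  show "greedy_seq a (\<lambda>l. if l < j then d l else 0)"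
    unfolding greedy_seq_def
  proof
    fix i
    have "(\<Sum>l<i. (if l < j then d l else 0) * a l) \<le> (\<Sum>l<i. d l * a l)"
      by (intro sum_mono) auto
    then show "(\<Sum>l<i. (if l < j then d l else 0) * a l) < a i"
      using assms unfolding greedy_seq_def using le_less_trans by blast
  qed
qed auto

lemma last_representation: "last (representation a n) = rep_digits a n 0"
proof -
  have "representation a n \<noteq> []"
    using length_greedy_digits[of a "GREATEST j. a j \<le> n" n] by (auto simp: representation_def)
  then show ?thesis
    by (simp add: rep_digits_def digit_def last_conv_nth rev_nth)
qed

text \<open>Padding does no harm here: a one-digit representation of the positive number
  \<open>n + 1\<close> has a nonzero digit, so two zeros at the end are genuine digits.\<close>

lemma volatile2_iff: "volatile2 a n \<longleftrightarrow> rep_digits a (n + 1) 0 = 0 \<and> rep_digits a (n + 1) 1 = 0"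
proof
  assume "volatile2 a n"
  then show "rep_digits a (n + 1) 0 = 0 \<and> rep_digits a (n + 1) 1 = 0"
    by (auto simp: volatile2_def rep_digits_def digit_def)
next
  assume *: "rep_digits a (n + 1) 0 = 0 \<and> rep_digits a (n + 1) 1 = 0"
  let ?r = "rev (representation a (n + 1))"
  have sum: "(\<Sum>l<length ?r. rep_digits a (n + 1) l * a l) = n + 1"
    using sum_rep_digits[OF less_representing_seq_length] by simp
  obtain x y ds where r: "?r = x # y # ds"
  proof (cases ?r rule: list.exhaust)
    case Nil
    then show ?thesis using sum by simp
  next
    case (Cons x xs)
    with sum * that show ?thesis by (cases xs) auto
  qed
  then have "representation a (n + 1) = rev ds @ [y, x]"
    by (metis append.assoc append_Cons append_Nil rev.simps(2) rev_rev_ident)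
  moreover have "x = 0" "y = 0"
    using * r arg_cong[OF r, of length] by (auto simp: rep_digits_def digit_def)
  ultimately show "volatile2 a n" by (auto simp: volatile2_def)
qed

lemma rep_digits_0_less: "rep_digits a n 0 < a 1"
  using greedy_seq_rep_digits[of n] rep
  by (auto simp: greedy_seq_def representing_seq_def dest: spec[of _ 1])

end

section \<open>Subtracting one\<close>

text \<open>Intended for \<open>j\<close> the lowest nonzero position of \<open>e\<close> and
  \<open>g\<close> the digits of the \<open>j\<close>-th weight minus one.\<close>

definition borrow :: "nat \<Rightarrow> (nat \<Rightarrow> nat) \<Rightarrow> (nat \<Rightarrow> nat) \<Rightarrow> nat \<Rightarrow> nat" where
  "borrow j g e l = (if l < j then g l else if l = j then e j - 1 else e l)"

text \<open>One unit of \<open>c j\<close> is traded for lower digits worth \<open>c j - 1\<close>.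
  The weights are arbitrary because the identity is applied both to \<open>a\<close> and to its
  promotion.\<close>

lemma sum_borrow:
  fixes c :: "nat \<Rightarrow> nat"
  assumes "\<And>l. l < j \<Longrightarrow> e l = 0" "e j > 0" "1 + (\<Sum>l<j. g l * c l) = c j" "j < i"
  shows "1 + (\<Sum>l<i. borrow j g e l * c l) = (\<Sum>l<i. e l * c l)"
  using Suc_leI[OF \<open>j < i\<close>]
proof (induction i rule: dec_induct)
  case base
  have "(\<Sum>l<j. borrow j g e l * c l) = (\<Sum>l<j. g l * c l)" "(\<Sum>l<j. e l * c l) = 0"
    using assms(1) by (auto simp: borrow_def)
  moreover obtain m where "e j = Suc m" using assms(2) gr0_implies_Suc by blast
  ultimately show ?case using assms(3) by (simp add: borrow_def)
next
  case (step i)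
  then show ?case by (simp add: borrow_def)
qed

lemma rep_digits_pred:
  assumes rep: "representing_seq a"
  obtains j where "rep_digits a (n + 1) j > 0" "\<And>l. l < j \<Longrightarrow> rep_digits a (n + 1) l = 0"
    "j \<le> n" "rep_digits a n = borrow j (rep_digits a (a j - 1)) (rep_digits a (n + 1))"
proof -
  let ?e = "rep_digits a (n + 1)"
  define j where "j = (LEAST l. ?e l > 0)"
  let ?g = "rep_digits a (a j - 1)"
  have L: "n + 1 < a (n + 1)" by (rule representing_seq_gt_index[OF rep])
  have sum_e: "(\<Sum>l<n + 1. ?e l * a l) = n + 1" by (rule sum_rep_digits[OF rep L])
  have "\<exists>l. ?e l > 0"
  proof (rule ccontr)
    assume "\<not> ?thesis"
    then have "(\<Sum>l<n + 1. ?e l * a l) = 0" by simp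
    with sum_e show False by simp
  qed
  then have j: "?e j > 0" unfolding j_def by (rule LeastI_ex)
  have below: "?e l = 0" if "l < j" for l
    using not_less_Least[of l "\<lambda>l. ?e l > 0"] that by (simp add: j_def)
  have high: "?e l = 0" if "l \<ge> n + 1" for l
    using rep_digits_eq_0[OF rep L that] .
  have jn: "j < n + 1"
    using j high by (metis not_le not_less_zero)
  have pos: "a j > 0" by (rule representing_seq_pos[OF rep])
  then have "1 + (\<Sum>l<j. ?g l * a l) = a j"
    using sum_rep_digits[OF rep, of "a j - 1" j] by simp
  note sum = sum_borrow[of j ?e ?g a, OF below j this]
  have "rep_digits a n = borrow j ?g ?e"
  proof (rule rep_digits_eqI[OF rep])
    show "greedy_seq a (borrow j ?g ?e)"
      unfolding greedy_seq_def
    proof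
      fix i
      show "(\<Sum>l<i. borrow j ?g ?e l * a l) < a i"
      \<comment> \<open>Beyond \<open>j\<close> the partial sums are one less than those of
        \<open>?e\<close>; up to \<open>j\<close> they are those of \<open>?g\<close>.\<close>
      proof (cases "j < i")
        case True
        have "(\<Sum>l<i. ?e l * a l) < a i"
          using greedy_seq_rep_digits[OF rep, of "n + 1"] unfolding greedy_seq_def by blast
        with sum[OF _ True] show ?thesis by linarith
      next
        case False
        then have "(\<Sum>l<i. borrow j ?g ?e l * a l) = (\<Sum>l<i. ?g l * a l)"
          by (intro sum.cong) (auto simp: borrow_def)
        then show ?thesis
          using greedy_seq_rep_digits[OF rep] by (simp add: greedy_seq_def)
      qed
    qed
    show "borrow j ?g ?e l = 0" if "n + 1 \<le> l" for l
      using high[OF that] that jn by (simp add: borrow_def)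
    show "(\<Sum>l<n + 1. borrow j ?g ?e l * a l) = n"
      using sum[OF _ jn] sum_e by linarith
  qed
  with that[of j] j below jn show ?thesis by simp
qed

section \<open>Promoted digits\<close>

text \<open>With this change of digits the two branches of \<open>promotion1\<close> merge into the
  single formula \<open>promotion1_eq\<close>.\<close>

definition promote :: "(nat \<Rightarrow> nat) \<Rightarrow> nat \<Rightarrow> nat" where
  "promote d l = (if l = 0 \<and> d 0 > 0 then d 0 + 1 else d l)"

text \<open>This is the \<open>P\<close> of the overview. Summing below \<open>n\<close> catches
  every nonzero digit, since \<open>n < a n\<close>.\<close>

definition promoted_value :: "(nat \<Rightarrow> nat) \<Rightarrow> nat \<Rightarrow> nat" where
  "promoted_value a n = (\<Sum>l<n. promote (rep_digits a n) l * promotion1 a l)"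

lemma promote_eq_0_iff: "promote d l = 0 \<longleftrightarrow> d l = 0"
  by (auto simp: promote_def)

text \<open>For \<open>j = 0\<close> this would fail if \<open>e 0 = 1\<close>: the promoted last
  digit then drops from 2 to 0.\<close>

lemma promote_borrow:
  assumes "j > 0"
  shows "promote (borrow j g e) = borrow j (promote g) (promote e)"
  using assms by (auto simp: promote_def borrow_def)

context
  fixes a b :: "nat \<Rightarrow> nat"
  assumes rep: "representing_seq a" and b: "b = promotion1 a"
begin

lemma promoted_value_eq_sum:
  assumes "n < a L"
  shows "promoted_value a n = (\<Sum>l<L. promote (rep_digits a n) l * b l)"
proof -
  have zero: "promote (rep_digits a n) l = 0" if "l \<ge> min n L" for l
    using that rep_digits_eq_0[OF rep assms, of l]
      rep_digits_eq_0[OF rep representing_seq_gt_index[OF rep], of n l]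
    by (auto simp: promote_eq_0_iff min_def split: if_splits)
  have "(\<Sum>l<M. promote (rep_digits a n) l * b l) =
      (\<Sum>l<min n L. promote (rep_digits a n) l * b l)" if "M \<ge> min n L" for M
    using that zero by (intro sum.mono_neutral_right) auto
  from this[of n] this[of L] show ?thesis by (simp add: promoted_value_def b)
qed

lemma promotion1_eq: "b j = 1 + (\<Sum>l<j. promote (rep_digits a (a j - 1)) l * b l)"
proof (cases j)
  case 0
  then show ?thesis by (simp add: b)
next
  case (Suc i)
  let ?n = "a (Suc i) - 1"
  have lt: "a i < a (Suc i)" and pos: "a i > 0"
    using rep representing_seq_pos[OF rep] by (auto simp: representing_seq_def strict_mono_less)
  \<comment> \<open>The leading index \<open>i\<close> guarantees that \<open>digit\<close> is read
    only within the representation.\<close>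
  have "(GREATEST j. a j \<le> ?n) = i"
  proof (rule Greatest_equality)
    show "a i \<le> ?n" using lt by simp
    fix y assume "a y \<le> ?n"
    then have "a y < a (Suc i)" using lt by simp
    then show "y \<le> i" using rep by (simp add: representing_seq_def strict_mono_less)
  qed
  then have "length (representation a ?n) = Suc i"
    using lt pos by (simp add: representation_def length_greedy_digits)
  then have digit: "digit a ?n l = rep_digits a ?n l" if "l \<le> i" for l
    using that by (simp add: rep_digits_def)
  have "(\<Sum>l = 1..i. digit a ?n l * b l) = (\<Sum>l = 1..i. promote (rep_digits a ?n) l * b l)"
    using digit by (intro sum.cong) (auto simp: promote_def)
  moreover have "(\<Sum>l<Suc i. promote (rep_digits a ?n) l * b l) =
      promote (rep_digits a ?n) 0 * b 0 + (\<Sum>l = 1..i. promote (rep_digits a ?n) l * b l)"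
    by (simp add: lessThan_Suc_atMost atMost_atLeast0 sum.atLeast_Suc_atMost)
  moreover have "(\<Sum>l = 0..i. digit a ?n l * b l) =
      digit a ?n 0 * b 0 + (\<Sum>l = 1..i. digit a ?n l * b l)"
    by (simp add: sum.atLeast_Suc_atMost)
  ultimately show ?thesis
    unfolding Suc using digit[of 0] by (simp add: b promote_def del: promotion1.simps(1))
qed

lemma promotion1_eq_promoted_value: "b j = 1 + promoted_value a (a j - 1)"
  using promotion1_eq[of j] promoted_value_eq_sum[of "a j - 1" j] representing_seq_pos[OF rep, of j]
  by simp

lemma promoted_value_Suc:
  "promoted_value a (n + 1) = promoted_value a n + (if rep_digits a (n + 1) 0 = 1 then 2 else 1)"
proof -
  let ?d = "rep_digits a n" and ?e = "rep_digits a (n + 1)"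
  obtain j where j: "?e j > 0" "\<And>l. l < j \<Longrightarrow> ?e l = 0" "j \<le> n"
    and d: "?d = borrow j (rep_digits a (a j - 1)) ?e"
    using rep_digits_pred[OF rep, where n = n] by blast
  have L: "n + 1 < a (n + 1)" by (rule representing_seq_gt_index[OF rep])
  have P: "promoted_value a n = (\<Sum>l<n + 1. promote ?d l * b l)"
    "promoted_value a (n + 1) = (\<Sum>l<n + 1. promote ?e l * b l)"
    using L by (intro promoted_value_eq_sum; simp)+
  show ?thesis
  proof (cases "j = 0")
    case True
    have "promote ?d (Suc l) = promote ?e (Suc l)" for l
      using True by (simp add: d borrow_def promote_def)
    \<comment> \<open>Promoted last digits run through 0, 2, 3, and so on, so the only gap of size 2
      lies between the images of 0 and 1.\<close>
    moreover have "promote ?e 0 = promote ?d 0 + (if ?e 0 = 1 then 2 else 1)"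
      using True j(1) by (auto simp: d borrow_def promote_def)
    ultimately show ?thesis
      using promotion1_eq[of 0]
      unfolding P unfolding Suc_eq_plus1[symmetric] sum.lessThan_Suc_shift by simp
  next
    case False
    \<comment> \<open>The recursion for \<open>b j\<close> is exactly the hypothesis of
      \<open>sum_borrow\<close> on the weights \<open>b\<close> and the promoted digits of
      \<open>a j - 1\<close>.\<close>
    have "1 + (\<Sum>l<n + 1. borrow j (promote (rep_digits a (a j - 1))) (promote ?e) l * b l)
        = (\<Sum>l<n + 1. promote ?e l * b l)"
      using j promotion1_eq[of j] False by (intro sum_borrow) (auto simp: promote_def)
    moreover have "?e 0 = 0" using False j(2) by simp
    ultimately show ?thesis
      using False by (simp only: P d promote_borrow) simp
  qed
qed

lemma strict_mono_promoted_value: "strict_mono (promoted_value a)"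
  unfolding strict_mono_Suc_iff using promoted_value_Suc by simp

lemma representing_seq_promotion1: "representing_seq b"
proof -
  have "b i < b (Suc i)" for i
  proof -
    have "a i - 1 < a (Suc i) - 1"
      using rep representing_seq_pos[OF rep, of i] strict_monoD[of a i "Suc i"]
      by (simp add: representing_seq_def)
    then show ?thesis
      unfolding promotion1_eq_promoted_value
      using strict_mono_promoted_value by (simp add: strict_mono_less)
  qed
  then show ?thesis by (simp add: representing_seq_def strict_mono_Suc_iff b)
qed

text \<open>The promoted partial sum is \<open>P\<close> at a number below \<open>a j\<close>; by
  monotonicity it is at most \<open>P (a j - 1) = b j - 1\<close>.\<close>

lemma greedy_seq_promote:
  assumes "greedy_seq a d"
  shows "greedy_seq b (promote d)"
  unfolding greedy_seq_def
proof
  fix j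
  let ?m = "\<Sum>l<j. d l * a l"
  have m: "?m < a j" using assms by (simp add: greedy_seq_def)
  have "(\<Sum>l<j. promote d l * b l) = promoted_value a ?m"
    unfolding promoted_value_eq_sum[OF m] rep_digits_truncate[OF rep assms]
    by (intro sum.cong) (auto simp: promote_def)
  also have "\<dots> \<le> promoted_value a (a j - 1)"
    using m strict_mono_promoted_value by (simp add: strict_mono_less_eq)
  also have "\<dots> < b j" by (simp add: promotion1_eq_promoted_value)
  finally show "(\<Sum>l<j. promote d l * b l) < b j" .
qed

lemma rep_digits_promoted_value:
  "rep_digits b (promoted_value a n) = promote (rep_digits a n)"
proof (rule rep_digits_eqI[OF representing_seq_promotion1])
  show "greedy_seq b (promote (rep_digits a n))"
    by (intro greedy_seq_promote greedy_seq_rep_digits rep)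
  show "(\<Sum>l<n. promote (rep_digits a n) l * b l) = promoted_value a n"
    by (simp add: promoted_value_def b)
  show "promote (rep_digits a n) l = 0" if "n \<le> l" for l
    using that rep_digits_eq_0[OF rep representing_seq_gt_index[OF rep], of n l]
    by (auto simp: promote_eq_0_iff)
qed

text \<open>This covers the value \<open>P n + 1\<close> that \<open>P\<close> skips. Promotion
  turns the last digit of \<open>n + 1\<close> into 2; lowering it back to 1 keeps the string greedy
  and subtracts one from \<open>P (n + 1) = P n + 2\<close>.\<close>

lemma rep_digits_Suc_promoted_value:
  assumes "rep_digits a (n + 1) 0 = 1"
  shows "rep_digits b (promoted_value a n + 1) = rep_digits a (n + 1)"
proof (rule rep_digits_eqI[OF representing_seq_promotion1])
  let ?e = "rep_digits a (n + 1)"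
  have "greedy_seq b (promote ?e)"
    by (intro greedy_seq_promote greedy_seq_rep_digits rep)
  moreover have "(\<Sum>l<j. ?e l * b l) \<le> (\<Sum>l<j. promote ?e l * b l)" for j
    by (intro sum_mono) (auto simp: promote_def)
  ultimately show "greedy_seq b ?e"
    unfolding greedy_seq_def using le_less_trans by blast
  show "?e l = 0" if "n + 1 \<le> l" for l
    using rep_digits_eq_0[OF rep representing_seq_gt_index[OF rep] that] .
  have "1 + (\<Sum>l<n + 1. ?e l * b l) = promoted_value a (n + 1)"
    unfolding promoted_value_def Suc_eq_plus1[symmetric] sum.lessThan_Suc_shift
    using assms by (simp add: b promote_def)
  then show "(\<Sum>l<n + 1. ?e l * b l) = promoted_value a n + 1"
    using assms promoted_value_Suc[of n] by simp
qed

text \<open>Needed for the letter of \<open>v\<close> at volatile positions. The number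
  \<open>a 1 - 1\<close> is a single positive digit.\<close>

lemma promotion1_at_1: "b 1 = a 1 + 1"
proof -
  have "a 1 > 1" using representing_seq_gt_index[OF rep, of 1] by simp
  moreover have "rep_digits a (a 1 - 1) 0 = a 1 - 1"
    using sum_rep_digits[OF rep, of "a 1 - 1" 1] rep \<open>a 1 > 1\<close>
    by (simp add: representing_seq_def)
  ultimately show ?thesis
    using promotion1_eq[of 1] by (simp add: promote_def b)
qed

end

text \<open>Locates the letter 0 in \<open>w\<close>. If the lowest nonzero digit of
  \<open>n + 1\<close> is at 0, the last digit just drops by one; if it is at 1, then
  \<open>n\<close> ends in \<open>a 1 - 1 > 0\<close>; if it is higher, \<open>n\<close> is
  volatile.\<close>

lemma last_digit_Suc_eq_1_iff:
  assumes rep: "representing_seq a"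
  shows "rep_digits a (n + 1) 0 = 1 \<longleftrightarrow> rep_digits a n 0 = 0 \<and> \<not> volatile2 a n"
proof -
  let ?e = "rep_digits a (n + 1)"
  obtain j where j: "?e j > 0" "\<And>l. l < j \<Longrightarrow> ?e l = 0"
    and d: "rep_digits a n = borrow j (rep_digits a (a j - 1)) ?e"
    using rep_digits_pred[OF rep, where n = n] by blast
  have a1: "a 1 > 1" using representing_seq_gt_index[OF rep, of 1] by simp
  have last: "rep_digits a (a 1 - 1) 0 = a 1 - 1"
    using sum_rep_digits[OF rep, of "a 1 - 1" 1] rep a1 by (simp add: representing_seq_def)
  consider "j = 0" | "j = 1" | "j > 1" by linarith
  then show ?thesis
  proof cases
    case 1
    then show ?thesis
      using j(1) by (auto simp: volatile2_iff[OF rep] d borrow_def)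
  next
    case 2
    then show ?thesis using a1 last j(2)[of 0] by (simp add: d borrow_def)
  next
    case 3
    then show ?thesis using j(2)[of 0] j(2)[of 1] by (simp add: volatile2_iff[OF rep])
  qed
qed

section \<open>Morphic images\<close>

text \<open>Here \<open>f n\<close> is the position where the image of the \<open>n\<close>-th
  letter starts. Nonempty blocks let strong induction on the position peel them off one at a
  time.\<close>

lemma flat_smap_eqI:
  assumes "f 0 = 0"
    and "\<And>n. h (w !! n) \<noteq> []"
    and "\<And>n. f (Suc n) = f n + length (h (w !! n))"
    and "\<And>n i. i < length (h (w !! n)) \<Longrightarrow> v !! (f n + i) = h (w !! n) ! i"
  shows "flat (smap h w) = v"
proof -
  have "flat (smap h (sdrop n w)) !! m = v !! (f n + m)" for n m
  proof (induction m arbitrary: n rule: less_induct)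
    case (less m)
    let ?x = "h (w !! n)"
    have eq: "flat (smap h (sdrop n w)) = ?x @- flat (smap h (sdrop (Suc n) w))"
      using assms(2)[of n] by (subst flat_unfold) (auto simp: sdrop_simps)
    show ?case
    proof (cases "m < length ?x")
      case True
      then show ?thesis unfolding eq using assms(4) by simp
    next
      case False
      moreover have "length ?x > 0" using assms(2) by simp
      ultimately have "m - length ?x < m" by linarith
      with False show ?thesis
        unfolding eq using less[of "m - length ?x" "Suc n"] assms(3)[of n]
        by (simp add: shift_snth_ge)
    qed
  qed
  from this[of 0] have "snth (flat (smap h w)) = snth v" by (simp add: assms(1) fun_eq_iff)
  then show ?thesis by (metis stream_smap_nats)
qed

theorem theoremE4:
  fixes a b :: "nat \<Rightarrow> nat" and k :: nat and w v :: "nat stream"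
  assumes "representing_seq a" and "a 1 = k"
    and "b = promotion1 a"
    and "w = representation_word a" and "v = representation_word b"
  shows "morphism_image (phi k) w = v"
proof -
  note rep = assms(1) and b = assms(3)
  note repb = representing_seq_promotion1[OF rep b]
  let ?P = "promoted_value a"
  have k: "k > 1" using representing_seq_gt_index[OF rep, of 1] assms(2) by simp
  have w: "w !! n = (if volatile2 a n then k else rep_digits a n 0)" for n
    using assms(2,4) by (simp add: snth_representation_word last_representation[OF rep])
  have v: "v !! n = (if volatile2 b n then k + 1 else rep_digits b n 0)" for n
    using assms(2) promotion1_at_1[OF rep b]
    by (simp add: assms(5) snth_representation_word last_representation[OF repb])
  have w0: "w !! n = 0 \<longleftrightarrow> rep_digits a (n + 1) 0 = 1" for n
    unfolding last_digit_Suc_eq_1_iff[OF rep] using k by (simp add: w)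
  \<comment> \<open>\<open>phi k\<close> is specified only on letters up to \<open>k\<close>; last
    digits are below \<open>a 1 = k\<close>.\<close>
  have phi: "phi k (w !! n) = (if w !! n = 0 then [0, 1] else [w !! n + 1])" for n
    using rep_digits_0_less[OF rep, of n] assms(2) by (auto simp: w phi_def)
  have P_Suc: "?P (n + 1) = ?P n + (if w !! n = 0 then 2 else 1)" for n
    by (simp only: promoted_value_Suc[OF rep b] w0)
  note digits = rep_digits_promoted_value[OF rep b]
  have "flat (smap (phi k) w) = v"
  proof (rule flat_smap_eqI[where f = ?P])
    show "?P 0 = 0" by (simp add: promoted_value_def)
    show "phi k (w !! n) \<noteq> []" for n by (simp add: phi)
    show "?P (Suc n) = ?P n + length (phi k (w !! n))" for n
      using P_Suc[of n] by (simp add: phi)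
    fix n i
    assume i: "i < length (phi k (w !! n))"
    show "v !! (?P n + i) = phi k (w !! n) ! i"
    proof (cases "w !! n = 0")
      case True
      then have e: "rep_digits a (n + 1) 0 = 1" and d: "rep_digits a n 0 = 0"
        using w0 last_digit_Suc_eq_1_iff[OF rep] by auto
      have e': "rep_digits b (?P n + 1) 0 = 1"
        using rep_digits_Suc_promoted_value[OF rep b e] e by simp
      \<comment> \<open>Neither position of the block 01 is volatile: \<open>?P n + 1\<close> ends
        in 1, and the next number is \<open>?P (n + 1)\<close>, which ends in 2.\<close>
      have "v !! ?P n = 0"
        using e' d by (simp add: v volatile2_iff[OF repb] digits promote_def)
      moreover have "rep_digits b (?P n + 1 + 1) 0 = 2"
        using P_Suc[of n] True digits[of "n + 1"] e by (simp add: promote_def)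
      then have "v !! (?P n + 1) = 1"
        using e' v[of "?P n + 1"] by (simp only: volatile2_iff[OF repb]) simp
      moreover have "i = 0 \<or> i = 1" using i phi[of n] True by auto
      ultimately show ?thesis using phi[of n] True by auto
    next
      case False
      \<comment> \<open>Now \<open>?P n + 1\<close> is \<open>?P (n + 1)\<close>, and promotion
        preserves zero digits, so volatility carries over. A volatile letter rises from
        \<open>k\<close> to \<open>k + 1\<close>, a positive last digit rises by one.\<close>
      have "rep_digits b (?P n + 1) = promote (rep_digits a (n + 1))"
        using P_Suc[of n] False digits[of "n + 1"] by simp
      then have "volatile2 b (?P n) \<longleftrightarrow> volatile2 a n"
        by (simp add: volatile2_iff[OF repb] volatile2_iff[OF rep] promote_def)
      then have "v !! ?P n = w !! n + 1"
        using False by (auto simp: v w digits promote_def)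
      then show ?thesis using False i by (simp add: phi)
    qed
  qed
  then show ?thesis by (simp add: morphism_image_def)
qed

end
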